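(* Let $\mathbf{Ring}$ be the category of rings with identity and $\mathbf{ParOrd}$ the category of partially ordered sets (with order-preserving maps). The assignment $R\mapsto \operatorname{Hom}(R)$ on objects, which sends a ring morphism $f\colon R\to R'$ to the mapping $\operatorname{Hom}(f)\colon \operatorname{Hom}(R')\to\operatorname{Hom}(R)$, $(\mathfrak a',M')\mapsto (f^{-1}(\mathfrak a'),f^{-1}(M'))$, is a contravariant functor $\operatorname{Hom}(-)\colon\mathbf{Ring}\to\mathbf{ParOrd}$.
   Context: All rings are associative with identity $1\neq 0$ and ring morphisms send $1$ to $1$. $U(S)$ denotes the group of two-sided invertible elements of a ring $S$. To a ring morphism $\varphi\colon R\to S$ one associates the pair $(\mathfrak a,M)$ with $\mathfrak a=\ker(\varphi)$ and $M=\varphi^{-1}(U(S))$. For a ring $R$, $\operatorname{Hom}(R)$ (with one argument) denotes the set of all pairs $(\mathfrak a,M)$ associated to ring morphisms $\varphi\colon R\to S$, with $S$ ranging over all rings, partially ordered by $(\mathfrak a,M)\le(\mathfrak b,N)$ if and only if $\mathfrak a\subseteq\mathfrak b$ and $M\subseteq N$. *)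

theory Defs
  imports "HOL-Algebra.Order" "HOL-Algebra.RingHom" "HOL-Algebra.Subrings" "HOL-Algebra.Weak_Morphisms"
begin

section \<open>Categories and contravariant functors\<close>

text \<open>
  Arrows need not determine their source and target: the arrow sets of different pairs of objects
  may overlap, so composition takes its three objects as arguments. In the term
  \<open>Cmp C A B D g f\<close> the arrow \<open>f\<close> goes from \<open>A\<close> to \<open>B\<close> and \<open>g\<close> from \<open>B\<close> to \<open>D\<close>.
\<close>

record ('o, 'm) cat =
  Ob  :: "'o set"
  Arr :: "'o \<Rightarrow> 'o \<Rightarrow> 'm set"
  Idn :: "'o \<Rightarrow> 'm"
  Cmp :: "'o \<Rightarrow> 'o \<Rightarrow> 'o \<Rightarrow> 'm \<Rightarrow> 'm \<Rightarrow> 'm"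

locale category =
  fixes C :: "('o, 'm) cat"
  assumes Idn_in_Arr: "A \<in> Ob C \<Longrightarrow> Idn C A \<in> Arr C A A"
    and Cmp_in_Arr:
      "\<lbrakk>A \<in> Ob C; B \<in> Ob C; D \<in> Ob C; f \<in> Arr C A B; g \<in> Arr C B D\<rbrakk>
        \<Longrightarrow> Cmp C A B D g f \<in> Arr C A D"
    and Cmp_Idn_right:
      "\<lbrakk>A \<in> Ob C; B \<in> Ob C; f \<in> Arr C A B\<rbrakk> \<Longrightarrow> Cmp C A A B f (Idn C A) = f"
    and Cmp_Idn_left:
      "\<lbrakk>A \<in> Ob C; B \<in> Ob C; f \<in> Arr C A B\<rbrakk> \<Longrightarrow> Cmp C A B B (Idn C B) f = f"
    and Cmp_assoc:
      "\<lbrakk>A \<in> Ob C; B \<in> Ob C; D \<in> Ob C; E \<in> Ob C;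
        f \<in> Arr C A B; g \<in> Arr C B D; h \<in> Arr C D E\<rbrakk>
        \<Longrightarrow> Cmp C A D E h (Cmp C A B D g f) = Cmp C A B E (Cmp C B D E h g) f"

locale contravariant_functor =
  source: category C + target: category D
  for C :: "('o, 'm) cat" and D :: "('p, 'n) cat" +
  fixes Fo :: "'o \<Rightarrow> 'p"
    and Fa :: "'o \<Rightarrow> 'o \<Rightarrow> 'm \<Rightarrow> 'n"
  assumes Fo_in_Ob: "A \<in> Ob C \<Longrightarrow> Fo A \<in> Ob D"
    and Fa_in_Arr:
      "\<lbrakk>A \<in> Ob C; B \<in> Ob C; f \<in> Arr C A B\<rbrakk> \<Longrightarrow> Fa A B f \<in> Arr D (Fo B) (Fo A)"
    and Fa_Idn: "A \<in> Ob C \<Longrightarrow> Fa A A (Idn C A) = Idn D (Fo A)"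
    and Fa_Cmp:
      "\<lbrakk>A \<in> Ob C; B \<in> Ob C; E \<in> Ob C; f \<in> Arr C A B; g \<in> Arr C B E\<rbrakk>
        \<Longrightarrow> Fa A E (Cmp C A B E g f) = Cmp D (Fo E) (Fo B) (Fo A) (Fa A B f) (Fa B E g)"

section \<open>The categories of rings and of partially ordered sets\<close>

text \<open>
  The type \<open>'a\<close> plays the role of the universe from which the elements of rings are taken.
  Morphisms are extensional functions, so that equality of arrows is equality on the carrier.
\<close>

definition nonzero_ring :: "('a, 'k) ring_scheme \<Rightarrow> bool" where
  "nonzero_ring R \<longleftrightarrow> ring R \<and> \<one>\<^bsub>R\<^esub> \<noteq> \<zero>\<^bsub>R\<^esub>"

definition RingCat :: "('a ring, 'a \<Rightarrow> 'a) cat" where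
  "RingCat = \<lparr>
     Ob = {R. nonzero_ring R},
     Arr = (\<lambda>R S. ring_hom R S \<inter> extensional (carrier R)),
     Idn = (\<lambda>R. \<lambda>x\<in>carrier R. x),
     Cmp = (\<lambda>R S T g f. compose (carrier R) g f) \<rparr>"

definition ParOrdCat :: "('p gorder, 'p \<Rightarrow> 'p) cat" where
  "ParOrdCat = \<lparr>
     Ob = {P. partial_order P},
     Arr = (\<lambda>P Q. {h \<in> carrier P \<rightarrow>\<^sub>E carrier Q. isotone P Q h}),
     Idn = (\<lambda>P. \<lambda>x\<in>carrier P. x),
     Cmp = (\<lambda>P Q T h k. compose (carrier P) h k) \<rparr>"

section \<open>The partially ordered set \<open>Hom(R)\<close>\<close>

definition ring_preimage :: "('a, 'k) ring_scheme \<Rightarrow> ('a \<Rightarrow> 'b) \<Rightarrow> 'b set \<Rightarrow> 'a set" where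
  "ring_preimage R f Y = {x \<in> carrier R. f x \<in> Y}"

definition assoc_pair ::
  "('a, 'k) ring_scheme \<Rightarrow> ('b, 'l) ring_scheme \<Rightarrow> ('a \<Rightarrow> 'b) \<Rightarrow> 'a set \<times> 'a set" where
  "assoc_pair R S \<phi> = (a_kernel R S \<phi>, ring_preimage R \<phi> (Units S))"

text \<open>
  The target \<open>S\<close> ranges over all rings in the universe \<open>'a\<close> of \<open>R\<close>. The lemma
  \<open>assoc_pair_in_Hom_pairs\<close> below shows that rings \<open>S\<close> over any other type contribute no
  further pairs.
\<close>

definition Hom_pairs :: "'a ring \<Rightarrow> ('a set \<times> 'a set) set" where
  "Hom_pairs R = {assoc_pair R S \<phi> | (S :: 'a ring) \<phi>. nonzero_ring S \<and> \<phi> \<in> ring_hom R S}"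

definition Hom_poset :: "'a ring \<Rightarrow> ('a set \<times> 'a set) gorder" where
  "Hom_poset R = \<lparr>
     carrier = Hom_pairs R,
     eq = (=),
     le = (\<lambda>(\<aa>, M) (\<bb>, N). \<aa> \<subseteq> \<bb> \<and> M \<subseteq> N) \<rparr>"

definition Hom_map ::
  "'a ring \<Rightarrow> 'a ring \<Rightarrow> ('a \<Rightarrow> 'a) \<Rightarrow> 'a set \<times> 'a set \<Rightarrow> 'a set \<times> 'a set" where
  "Hom_map R R' f = (\<lambda>(\<aa>', M') \<in> Hom_pairs R'. (ring_preimage R f \<aa>', ring_preimage R f M'))"

section \<open>Independence of the universe of the target rings\<close>

lemma card_closure_infinite:
  includes cardinal_syntax
  fixes G :: "'b set" and h k :: "'b \<Rightarrow> 'b \<Rightarrow> 'b"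
  assumes inf: "infinite U" and G: "|G| \<le>o |U|"
  obtains T where "G \<subseteq> T" "|T| \<le>o |U|"
    "\<And>x y. x \<in> T \<Longrightarrow> y \<in> T \<Longrightarrow> h x y \<in> T" "\<And>x y. x \<in> T \<Longrightarrow> y \<in> T \<Longrightarrow> k x y \<in> T"
    "\<And>Y. G \<subseteq> Y \<Longrightarrow> (\<And>x y. x \<in> Y \<Longrightarrow> y \<in> Y \<Longrightarrow> h x y \<in> Y \<and> k x y \<in> Y) \<Longrightarrow> T \<subseteq> Y"
proof -
  define F where "F Y = Y \<union> case_prod h ` (Y \<times> Y) \<union> case_prod k ` (Y \<times> Y)" for Y
  define T where "T = (\<Union>n. (F ^^ n) G)"
  have cardF: "|F Y| \<le>o |U|" if Y: "|Y| \<le>o |U|" for Y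
  proof -
    have XX: "|Y \<times> Y| \<le>o |U|"
      using inf Y by (intro card_of_Times_ordLeq_infinite_Field) (auto simp: card_of_card_order_on Field_card_of)
    have "|case_prod h ` (Y \<times> Y)| \<le>o |U|" "|case_prod k ` (Y \<times> Y)| \<le>o |U|"
      using XX card_of_image ordLeq_transitive by blast+
    then show ?thesis unfolding F_def
      using inf Y by (intro card_of_Un_ordLeq_infinite_Field) (auto simp: card_of_card_order_on Field_card_of)
  qed
  have cardn: "|(F ^^ n) G| \<le>o |U|" for n
    by (induction n) (auto simp: G cardF)
  have "|T| \<le>o |U|" unfolding T_def
    using inf cardn infinite_iff_card_of_nat by (intro card_of_UNION_ordLeq_infinite) auto
  have step: "(F ^^ n) G \<subseteq> (F ^^ Suc n) G" for n by (auto simp: F_def)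
  have mono: "(F ^^ m) G \<subseteq> (F ^^ n) G" if "m \<le> n" for m n
    using that step by (rule lift_Suc_mono_le[where f = "\<lambda>n. (F ^^ n) G", rotated])
  have closed: "h x y \<in> T \<and> k x y \<in> T" if xy: "x \<in> T" "y \<in> T" for x y
  proof -
    obtain m n where mn: "x \<in> (F ^^ m) G" "y \<in> (F ^^ n) G" using xy unfolding T_def by blast
    then have "x \<in> (F ^^ (max m n)) G" "y \<in> (F ^^ (max m n)) G"
      using mono[of m "max m n"] mono[of n "max m n"] by auto
    then have "h x y \<in> (F ^^ Suc (max m n)) G \<and> k x y \<in> (F ^^ Suc (max m n)) G"
      by (auto simp: F_def)
    then show ?thesis unfolding T_def by blast
  qed
  have min: "T \<subseteq> Y"
    if GY: "G \<subseteq> Y" and cl: "\<And>x y. x \<in> Y \<Longrightarrow> y \<in> Y \<Longrightarrow> h x y \<in> Y \<and> k x y \<in> Y" for Y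
  proof -
    have "F Z \<subseteq> Y" if "Z \<subseteq> Y" for Z
      unfolding F_def using that cl by (auto simp: subset_iff)
    then have "(F ^^ n) G \<subseteq> Y" for n by (induction n) (use GY in auto)
    then show ?thesis unfolding T_def by blast
  qed
  have "G \<subseteq> (F ^^ 0) G" by simp
  then have "G \<subseteq> T" unfolding T_def by blast
  then show thesis
    using that \<open>|T| \<le>o |U|\<close> closed min by blast
qed

lemma small_subring_with_inverses:
  includes cardinal_syntax
  fixes R :: "('a, 'k) ring_scheme" and S :: "('b, 'l) ring_scheme"
  assumes R: "ring R" and S: "ring S" and \<phi>: "\<phi> \<in> ring_hom R S"
  obtains T where "subring T S" "\<phi> ` carrier R \<subseteq> T"
    "\<And>x. x \<in> carrier R \<Longrightarrow> \<phi> x \<in> Units S \<Longrightarrow> inv\<^bsub>S\<^esub> (\<phi> x) \<in> T"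
    "|T| \<le>o |carrier R|"
proof -
  interpret R: ring R by fact
  interpret S: ring S by fact
  interpret h: ring_hom_ring R S \<phi> by unfold_locales (fact \<phi>)
  show thesis
  proof (cases "finite (carrier R)")
    case True
    define T where "T = \<phi> ` carrier R"
    have T: "subring T S" unfolding T_def
      by (rule h.img_is_subring[OF R.carrier_is_subring])
    have fin: "finite T" unfolding T_def using True by simp
    have sub: "T \<subseteq> carrier S" using subringE(1)[OF T] .
    have "inv\<^bsub>S\<^esub> u \<in> T" if u: "u \<in> T" "u \<in> Units S" for u
    proof -
      let ?m = "\<lambda>t. t \<otimes>\<^bsub>S\<^esub> u"
      have "inj_on ?m T"
      proof (rule inj_onI)
        fix s t assume st: "s \<in> T" "t \<in> T" "s \<otimes>\<^bsub>S\<^esub> u = t \<otimes>\<^bsub>S\<^esub> u"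
        then have "s \<otimes>\<^bsub>S\<^esub> u \<otimes>\<^bsub>S\<^esub> inv\<^bsub>S\<^esub> u = t \<otimes>\<^bsub>S\<^esub> u \<otimes>\<^bsub>S\<^esub> inv\<^bsub>S\<^esub> u" by simp
        moreover have "r \<otimes>\<^bsub>S\<^esub> u \<otimes>\<^bsub>S\<^esub> inv\<^bsub>S\<^esub> u = r" if "r \<in> T" for r
          using subsetD[OF sub that] S.Units_closed[OF u(2)] u(2) by (simp add: S.m_assoc)
        ultimately show "s = t" using st(1,2) by metis
      qed
      moreover have "?m ` T \<subseteq> T" using subringE(6)[OF T] u by auto
      ultimately have "?m ` T = T" using fin by (simp add: endo_inj_surj)
      then have "\<one>\<^bsub>S\<^esub> \<in> ?m ` T" using subringE(3)[OF T] by simp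
      then obtain t where t: "t \<in> T" "t \<otimes>\<^bsub>S\<^esub> u = \<one>\<^bsub>S\<^esub>" by auto
      then have "inv\<^bsub>S\<^esub> u = t"
        using S.inv_unique[of t u "inv\<^bsub>S\<^esub> u"] subsetD[OF sub t(1)] S.Units_closed[OF u(2)] u(2)
        by simp
      then show ?thesis using t by simp
    qed
    then show thesis using that[of T] T by (auto simp: T_def card_of_image)
  next
    case False
    define I where "I = (\<lambda>x. inv\<^bsub>S\<^esub> (\<phi> x)) ` {x \<in> carrier R. \<phi> x \<in> Units S}"
    define G where "G = \<phi> ` carrier R \<union> I"
    have "|{x \<in> carrier R. \<phi> x \<in> Units S}| \<le>o |carrier R|"
      by (rule card_of_mono1) auto
    then have "|I| \<le>o |carrier R|"
      unfolding I_def using card_of_image ordLeq_transitive by blast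
    then have "|G| \<le>o |carrier R|" unfolding G_def
      using False by (intro card_of_Un_ordLeq_infinite_Field)
        (auto simp: card_of_image card_of_card_order_on Field_card_of)
    then obtain T where T: "G \<subseteq> T" "|T| \<le>o |carrier R|"
      "\<And>x y. x \<in> T \<Longrightarrow> y \<in> T \<Longrightarrow> x \<ominus>\<^bsub>S\<^esub> y \<in> T"
      "\<And>x y. x \<in> T \<Longrightarrow> y \<in> T \<Longrightarrow> x \<otimes>\<^bsub>S\<^esub> y \<in> T"
      "\<And>Y. G \<subseteq> Y \<Longrightarrow> (\<And>x y. x \<in> Y \<Longrightarrow> y \<in> Y \<Longrightarrow> x \<ominus>\<^bsub>S\<^esub> y \<in> Y \<and> x \<otimes>\<^bsub>S\<^esub> y \<in> Y)
         \<Longrightarrow> T \<subseteq> Y"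
      using card_closure_infinite[OF False, of G "\<lambda>x y. x \<ominus>\<^bsub>S\<^esub> y" "\<lambda>x y. x \<otimes>\<^bsub>S\<^esub> y"] by blast
    have "G \<subseteq> carrier S" unfolding G_def I_def by auto
    then have sub: "T \<subseteq> carrier S" by (intro T(5)) auto
    have one: "\<one>\<^bsub>S\<^esub> \<in> T"
      using T(1) h.hom_one R.one_closed unfolding G_def by (metis UnCI image_eqI subsetD)
    then have zero: "\<zero>\<^bsub>S\<^esub> \<in> T" using T(3)[OF one one] by (simp add: a_minus_def S.r_neg)
    have neg: "\<ominus>\<^bsub>S\<^esub> x \<in> T" if "x \<in> T" for x
      using T(3)[OF zero that] that sub by (simp add: a_minus_def subset_eq)
    have add: "x \<oplus>\<^bsub>S\<^esub> y \<in> T" if "x \<in> T" "y \<in> T" for x y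
      using T(3)[OF that(1) neg[OF that(2)]] that sub by (simp add: a_minus_def subset_eq)
    have "subring T S"
      using sub one neg T(4) add by (rule S.subringI)
    then show thesis
      using that[of T] T(1,2) unfolding G_def I_def by blast
  qed
qed

lemma assoc_pair_in_Hom_pairs:
  includes cardinal_syntax
  fixes R :: "'a ring" and S :: "('b, 'l) ring_scheme"
  assumes R: "nonzero_ring R" and S: "nonzero_ring S" and \<phi>: "\<phi> \<in> ring_hom R S"
  shows "assoc_pair R S \<phi> \<in> Hom_pairs R"
proof -
  interpret R: ring R using R by (simp add: nonzero_ring_def)
  interpret S: ring S using S by (simp add: nonzero_ring_def)
  obtain T where T: "subring T S" "\<phi> ` carrier R \<subseteq> T"
    "\<And>x. x \<in> carrier R \<Longrightarrow> \<phi> x \<in> Units S \<Longrightarrow> inv\<^bsub>S\<^esub> (\<phi> x) \<in> T" "|T| \<le>o |carrier R|"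
    using small_subring_with_inverses[OF R.ring_axioms S.ring_axioms \<phi>] by blast
  have sub: "T \<subseteq> carrier S" using subringE(1)[OF T(1)] .
  obtain g :: "'b \<Rightarrow> 'a" where g: "inj_on g T"
    using T(4) unfolding card_of_ordLeq[symmetric] by blast
  define T' where "T' = S\<lparr>carrier := T\<rparr>"
  interpret T': ring T' unfolding T'_def by (rule S.subring_is_ring[OF T(1)])
  have T'_simps [simp]: "carrier T' = T" "mult T' = mult S" "add T' = add S"
    "\<one>\<^bsub>T'\<^esub> = \<one>\<^bsub>S\<^esub>" "\<zero>\<^bsub>T'\<^esub> = \<zero>\<^bsub>S\<^esub>"
    by (simp_all add: T'_def)
  define Q where "Q = image_ring g T'"
  have one: "\<one>\<^bsub>S\<^esub> \<in> T" and zero: "\<zero>\<^bsub>S\<^esub> \<in> T" using subringE(2,3)[OF T(1)] by auto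
  have Q_simps [simp]: "carrier Q = g ` T" "\<one>\<^bsub>Q\<^esub> = g \<one>\<^bsub>S\<^esub>" "\<zero>\<^bsub>Q\<^esub> = g \<zero>\<^bsub>S\<^esub>"
    "\<And>x y. x \<in> T \<Longrightarrow> y \<in> T \<Longrightarrow> g x \<otimes>\<^bsub>Q\<^esub> g y = g (x \<otimes>\<^bsub>S\<^esub> y)"
    "\<And>x y. x \<in> T \<Longrightarrow> y \<in> T \<Longrightarrow> g x \<oplus>\<^bsub>Q\<^esub> g y = g (x \<oplus>\<^bsub>S\<^esub> y)"
    using g by (simp_all add: Q_def image_ring_def image_group_def monoid.defs inv_into_f_f)
  have "weak_ring_morphism g {\<zero>\<^bsub>T'\<^esub>} T'"
  proof (intro weak_ring_morphism.intro weak_ring_morphism_axioms.intro)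
    show "ideal {\<zero>\<^bsub>T'\<^esub>} T'" by (rule T'.zeroideal)
    show "g a = g b \<longleftrightarrow> a \<ominus>\<^bsub>T'\<^esub> b \<in> {\<zero>\<^bsub>T'\<^esub>}" if "a \<in> carrier T'" "b \<in> carrier T'" for a b
      using that g T'.r_right_minus_eq[of a b] by (auto dest: inj_onD)
  qed
  then have Q: "ring Q" unfolding Q_def by (rule T'.image_ring_is_ring)
  have ne: "nonzero_ring Q"
    using Q S one zero g by (auto simp: nonzero_ring_def dest: inj_onD)
  have \<phi>T: "\<phi> x \<in> T" if "x \<in> carrier R" for x using T(2) that by blast
  have hom: "g \<circ> \<phi> \<in> ring_hom R Q"
    using \<phi> \<phi>T by (auto simp: ring_hom_def)
  have mult: "x \<otimes>\<^bsub>S\<^esub> y \<in> T" if "x \<in> T" "y \<in> T" for x y using subringE(6)[OF T(1)] that .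
  have units: "g (\<phi> x) \<in> Units Q \<longleftrightarrow> \<phi> x \<in> Units S" if x: "x \<in> carrier R" for x
  proof
    assume "g (\<phi> x) \<in> Units Q"
    then obtain t where "t \<in> T" "g t \<otimes>\<^bsub>Q\<^esub> g (\<phi> x) = \<one>\<^bsub>Q\<^esub>" "g (\<phi> x) \<otimes>\<^bsub>Q\<^esub> g t = \<one>\<^bsub>Q\<^esub>"
      by (auto simp: Units_def simp del: Q_simps(2-5))
    then have "t \<in> T" "t \<otimes>\<^bsub>S\<^esub> \<phi> x = \<one>\<^bsub>S\<^esub>" "\<phi> x \<otimes>\<^bsub>S\<^esub> t = \<one>\<^bsub>S\<^esub>"
      using g one mult \<phi>T[OF x] by (auto dest: inj_onD)
    then show "\<phi> x \<in> Units S" using sub \<phi>T[OF x] by (auto simp: Units_def)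
  next
    assume u: "\<phi> x \<in> Units S"
    then have "inv\<^bsub>S\<^esub> (\<phi> x) \<in> T" using T(3) x by blast
    then show "g (\<phi> x) \<in> Units Q"
      using u \<phi>T[OF x] unfolding Units_def[of Q]
      by (auto intro!: bexI[of _ "inv\<^bsub>S\<^esub> (\<phi> x)"])
  qed
  have "assoc_pair R S \<phi> = assoc_pair R Q (g \<circ> \<phi>)"
    using g zero \<phi>T units
    by (auto simp: assoc_pair_def a_kernel_def' ring_preimage_def dest: inj_onD)
  then show ?thesis using ne hom unfolding Hom_pairs_def by blast
qed

end

theory Submission
  imports Defs "HOL-Algebra.QuotRing"
begin

text \<open>
  Everything reduces to one observation: pulling back along \<open>f\<close> is precomposition with \<open>f\<close>. If
  \<open>(\<aa>', M')\<close> is the pair associated to \<open>\<phi> : R' \<rightarrow> S\<close>, then \<open>f\<^sup>-\<^sup>1(ker \<phi>) = ker (\<phi> \<circ> f)\<close>, and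
  \<open>x \<in> f\<^sup>-\<^sup>1(\<phi>\<^sup>-\<^sup>1(U(S)))\<close> if and only if \<open>(\<phi> \<circ> f) x \<in> U(S)\<close>, so \<open>(f\<^sup>-\<^sup>1(\<aa>'), f\<^sup>-\<^sup>1(M'))\<close> is the
  pair associated to \<open>\<phi> \<circ> f : R \<rightarrow> S\<close> (lemma \<open>preimage_assoc_pair\<close>). Since the target \<open>S\<close> stays
  the same, it remains nonzero and in the universe, so \<open>Hom(f)\<close> takes values in \<open>Hom(R)\<close>.

  The rest is formal. Preimages preserve inclusions, so \<open>Hom(f)\<close> is order-preserving; and
  preimages turn identities into identities and reverse the order of composition. The identity
  law needs the members of \<open>Hom(R)\<close> to be pairs of subsets of \<open>R\<close>, because a preimage only
  retains elements of the carrier of the domain.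
\<close>

lemma a_kernel_eq_ring_preimage: "a_kernel R S \<phi> = ring_preimage R \<phi> {\<zero>\<^bsub>S\<^esub>}"
  by (auto simp: a_kernel_def' ring_preimage_def)

lemma ring_preimage_mono: "Y \<subseteq> Z \<Longrightarrow> ring_preimage R f Y \<subseteq> ring_preimage R f Z"
  by (auto simp: ring_preimage_def)

lemma ring_preimage_comp:
  assumes "f \<in> carrier R \<rightarrow> carrier R'"
  shows "ring_preimage R f (ring_preimage R' g Y) = ring_preimage R (g \<circ> f) Y"
  using assms by (auto simp: ring_preimage_def)

lemma ring_preimage_restrict_id:
  "Y \<subseteq> carrier R \<Longrightarrow> ring_preimage R (\<lambda>x\<in>carrier R. x) Y = Y"
  by (auto simp: ring_preimage_def)

text \<open>
  Both components of an associated pair are preimages under \<open>\<phi>\<close>, of the zero ideal and of the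
  group of units, so functoriality of preimages treats them alike.
\<close>

lemma preimage_assoc_pair:
  assumes "f \<in> carrier R \<rightarrow> carrier R'"
  shows "map_prod (ring_preimage R f) (ring_preimage R f) (assoc_pair R' S \<phi>)
    = assoc_pair R S (\<phi> \<circ> f)"
  by (simp add: assoc_pair_def a_kernel_eq_ring_preimage ring_preimage_comp[OF assms])

lemma Hom_pairs_subset_carrier:
  assumes "(\<aa>, M) \<in> Hom_pairs R"
  shows "\<aa> \<subseteq> carrier R" "M \<subseteq> carrier R"
  using assms
  by (auto simp: Hom_pairs_def assoc_pair_def a_kernel_eq_ring_preimage ring_preimage_def)

lemma Hom_map_apply:
  assumes "p \<in> Hom_pairs R'"
  shows "Hom_map R R' f p = map_prod (ring_preimage R f) (ring_preimage R f) p"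
  using assms by (simp add: Hom_map_def map_prod_def)

lemma Hom_map_in_Hom_pairs:
  assumes f: "f \<in> ring_hom R R'" and p: "p \<in> Hom_pairs R'"
  shows "Hom_map R R' f p \<in> Hom_pairs R"
proof -
  obtain S :: "'a ring" and \<phi> where S: "nonzero_ring S" "\<phi> \<in> ring_hom R' S"
    and p_eq: "p = assoc_pair R' S \<phi>"
    using p by (auto simp: Hom_pairs_def)
  have "f \<in> carrier R \<rightarrow> carrier R'" using f by (auto simp: ring_hom_def)
  then have "Hom_map R R' f p = assoc_pair R S (\<phi> \<circ> f)"
    using p by (simp add: Hom_map_apply p_eq preimage_assoc_pair)
  then show ?thesis
    using S ring_hom_trans[OF f S(2)] by (auto simp: Hom_pairs_def)
qed

lemma Hom_map_extensional: "Hom_map R R' f \<in> extensional (Hom_pairs R')"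
  by (simp add: Hom_map_def)

lemma Hom_map_id: "Hom_map R R (\<lambda>x\<in>carrier R. x) = (\<lambda>p\<in>Hom_pairs R. p)"
proof (rule extensionalityI[OF Hom_map_extensional])
  fix p assume p: "p \<in> Hom_pairs R"
  obtain \<aa> M where "p = (\<aa>, M)" by fastforce
  with p show "Hom_map R R (\<lambda>x\<in>carrier R. x) p = (\<lambda>p\<in>Hom_pairs R. p) p"
    by (simp add: Hom_map_apply ring_preimage_restrict_id Hom_pairs_subset_carrier)
qed simp

lemma Hom_map_compose:
  assumes f: "f \<in> ring_hom A B" and g: "g \<in> ring_hom B E"
  shows "Hom_map A E (compose (carrier A) g f)
    = compose (Hom_pairs E) (Hom_map A B f) (Hom_map B E g)"
proof (rule extensionalityI[OF Hom_map_extensional compose_extensional])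
  fix p assume p: "p \<in> Hom_pairs E"
  have fc: "f \<in> carrier A \<rightarrow> carrier B" using f by (auto simp: ring_hom_def)
  have "ring_preimage A (compose (carrier A) g f) Y = ring_preimage A f (ring_preimage B g Y)"
    for Y
    using fc by (auto simp: ring_preimage_def compose_eq)
  then show "Hom_map A E (compose (carrier A) g f) p
      = compose (Hom_pairs E) (Hom_map A B f) (Hom_map B E g) p"
    using p Hom_map_in_Hom_pairs[OF g p]
    by (cases p) (simp add: compose_eq Hom_map_apply)
qed

lemma partial_order_Hom_poset: "partial_order (Hom_poset R)"
  by unfold_locales (auto simp: Hom_poset_def)

lemma isotone_Hom_map: "isotone (Hom_poset R') (Hom_poset R) (Hom_map R R' f)"
proof (rule isotoneI)
  show "weak_partial_order (Hom_poset R')" "weak_partial_order (Hom_poset R)"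
    using partial_order_Hom_poset by (auto simp: partial_order_def)
next
  fix p q
  assume "p \<in> carrier (Hom_poset R')" "q \<in> carrier (Hom_poset R')" "p \<sqsubseteq>\<^bsub>Hom_poset R'\<^esub> q"
  then show "Hom_map R R' f p \<sqsubseteq>\<^bsub>Hom_poset R\<^esub> Hom_map R R' f q"
    by (cases p, cases q) (simp add: Hom_poset_def Hom_map_apply ring_preimage_mono)
qed

text \<open>
  Outside the carrier, arrows take the default value \<open>undefined\<close>. Identities and composites are
  therefore only restrictions of \<open>id\<close> and \<open>g \<circ> f\<close>, and they are morphisms because a ring
  morphism can be changed outside its domain. This uses that the domain is a ring, whose
  operations do not lead out of the carrier.
\<close>

lemma category_RingCat: "category RingCat"
proof
  fix A :: "'a ring"
  assume "A \<in> Ob RingCat"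
  then have A: "ring A" by (simp add: RingCat_def nonzero_ring_def)
  have "(\<lambda>x\<in>carrier A. x) \<in> ring_hom A A"
    by (rule ring.ring_hom_restrict[OF A id_ring_hom]) simp
  then show "Idn RingCat A \<in> Arr RingCat A A" by (simp add: RingCat_def)
next
  fix A B D :: "'a ring" and f g
  assume "A \<in> Ob RingCat"
  then have A: "ring A" by (simp add: RingCat_def nonzero_ring_def)
  assume "f \<in> Arr RingCat A B" "g \<in> Arr RingCat B D"
  then have "g \<circ> f \<in> ring_hom A D" by (auto simp: RingCat_def intro: ring_hom_trans)
  then have "compose (carrier A) g f \<in> ring_hom A D"
    by (rule ring.ring_hom_restrict[OF A]) (simp add: compose_eq)
  then show "Cmp RingCat A B D g f \<in> Arr RingCat A D" by (simp add: RingCat_def)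
next
  fix A B :: "'a ring" and f
  assume "f \<in> Arr RingCat A B"
  then have "f \<in> carrier A \<rightarrow> carrier B" "f \<in> extensional (carrier A)"
    by (auto simp: RingCat_def ring_hom_def)
  then show "Cmp RingCat A A B f (Idn RingCat A) = f" "Cmp RingCat A B B (Idn RingCat B) f = f"
    by (simp_all add: RingCat_def compose_Id Id_compose)
next
  fix A B D E :: "'a ring" and f g h
  assume "f \<in> Arr RingCat A B"
  then have "f \<in> carrier A \<rightarrow> carrier B" by (auto simp: RingCat_def ring_hom_def)
  then show "Cmp RingCat A D E h (Cmp RingCat A B D g f)
      = Cmp RingCat A B E (Cmp RingCat B D E h g) f"
    by (simp add: RingCat_def compose_assoc)
qed

lemma category_ParOrdCat: "category ParOrdCat"
proof
  fix A :: "'p gorder"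
  assume "A \<in> Ob ParOrdCat"
  then show "Idn ParOrdCat A \<in> Arr ParOrdCat A A"
    by (auto simp: ParOrdCat_def partial_order_def intro!: isotoneI)
next
  fix A B D :: "'p gorder" and f g
  assume "f \<in> Arr ParOrdCat A B" "g \<in> Arr ParOrdCat B D"
  then show "Cmp ParOrdCat A B D g f \<in> Arr ParOrdCat A D"
    by (auto simp: ParOrdCat_def isotone_def compose_def PiE_iff)
next
  fix A B :: "'p gorder" and f
  assume "f \<in> Arr ParOrdCat A B"
  then have "f \<in> carrier A \<rightarrow> carrier B" "f \<in> extensional (carrier A)"
    by (auto simp: ParOrdCat_def PiE_def)
  then show "Cmp ParOrdCat A A B f (Idn ParOrdCat A) = f"
    "Cmp ParOrdCat A B B (Idn ParOrdCat B) f = f"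
    by (simp_all add: ParOrdCat_def compose_Id Id_compose)
next
  fix A B D E :: "'p gorder" and f g h
  assume "f \<in> Arr ParOrdCat A B"
  then have "f \<in> carrier A \<rightarrow> carrier B" by (auto simp: ParOrdCat_def)
  then show "Cmp ParOrdCat A D E h (Cmp ParOrdCat A B D g f)
      = Cmp ParOrdCat A B E (Cmp ParOrdCat B D E h g) f"
    by (simp add: ParOrdCat_def compose_assoc)
qed

theorem proposition2p5:
  shows "contravariant_functor (RingCat :: ('a ring, 'a \<Rightarrow> 'a) cat)
           (ParOrdCat :: (('a set \<times> 'a set) gorder, 'a set \<times> 'a set \<Rightarrow> 'a set \<times> 'a set) cat)
           Hom_poset Hom_map"
proof (intro contravariant_functor.intro contravariant_functor_axioms.intro
    category_RingCat category_ParOrdCat)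
  fix A :: "'a ring"
  show "Hom_poset A \<in> Ob ParOrdCat"
    by (simp add: ParOrdCat_def partial_order_Hom_poset)
  show "Hom_map A A (Idn RingCat A) = Idn ParOrdCat (Hom_poset A)"
    using Hom_map_id[of A] by (simp add: RingCat_def ParOrdCat_def Hom_poset_def)
next
  fix A B :: "'a ring" and f
  assume "f \<in> Arr RingCat A B"
  then have f: "f \<in> ring_hom A B" by (simp add: RingCat_def)
  have "Hom_map A B f \<in> Hom_pairs B \<rightarrow>\<^sub>E Hom_pairs A"
    using Hom_map_in_Hom_pairs[OF f] Hom_map_extensional by (auto simp: PiE_def)
  then show "Hom_map A B f \<in> Arr ParOrdCat (Hom_poset B) (Hom_poset A)"
    using isotone_Hom_map by (simp add: ParOrdCat_def Hom_poset_def)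
next
  fix A B E :: "'a ring" and f g
  assume "f \<in> Arr RingCat A B" "g \<in> Arr RingCat B E"
  then show "Hom_map A E (Cmp RingCat A B E g f)
      = Cmp ParOrdCat (Hom_poset E) (Hom_poset B) (Hom_poset A) (Hom_map A B f) (Hom_map B E g)"
    using Hom_map_compose[of f A B g E] by (simp add: RingCat_def ParOrdCat_def Hom_poset_def)
qed

end
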